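(* There is a natural isomorphism $\eta\colon\mathcal{P}^{(-)}\Rightarrow\hat{H}$ of functors $\mathsf{Plas}\to\mathsf{Mod}_{\mathbb{F}_1}$.
   Context: Plasmas. A plasma is a triple $(M,\boxplus,e)$ with $M$ a set, $\boxplus\colon M\times M\to\mathcal{P}(M)$ a function to the power set of $M$ and $e\in M$, such that $a\in e\boxplus a$ for all $a\in M$ and $a\boxplus b=b\boxplus a$ for all $a,b\in M$. A morphism $(M,\boxplus,e)\to(M',\star,e')$ is a function $f\colon M\to M'$ with $f(e)=e'$ and $f(a\boxplus b)\subseteq f(a)\star f(b)$. These form the category $\mathsf{Plas}$. $\mathbb{F}_1$-modules. $\mathsf{Fin}_\ast$ is the category whose objects are the pointed sets $\langle n\rangle=\{0,1,\ldots,n\}$, $n\ge 0$, with basepoint $0$, and whose morphisms are pointed functions. An $\mathbb{F}_1$-module is a functor $X\colon\mathsf{Fin}_\ast\to\mathsf{Set}_\ast$ to pointed sets such that $X(\langle 0\rangle)$ is a singleton; $\mathsf{Mod}_{\mathbb{F}_1}$ is the category of these and natural transformations. The plasmas $\mathcal{P}(n)$. For $n\ge 0$ let $[n]=\{1,\ldots,n\}$ ($[0]=\varnothing$) and let $\mathcal{P}(n)$ be the set of subsets of $[n]$, with weak unit the element given by the empty subset and hyperoperation $X\curlyvee Y=\{X\cup Y\}$ if $X\cap Y=\varnothing$, and $X\curlyvee Y$ the empty set of elements of $\mathcal{P}(n)$ if $X\cap Y\neq\varnothing$. A morphism $\phi\colon\langle n\rangle\to\langle m\rangle$ of $\mathsf{Fin}_\ast$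 induces the plasma morphism $\mathcal{P}(\phi)\colon\mathcal{P}(m)\to\mathcal{P}(n)$, $X\mapsto\phi^{-1}(X)$. This gives a functor $\mathcal{P}\colon\mathsf{Fin}_\ast^{\mathrm{op}}\to\mathsf{Plas}$. For a plasma $M$, $\mathcal{P}^M\colon\mathsf{Fin}_\ast\to\mathsf{Set}_\ast$ is $\langle n\rangle\mapsto\mathsf{Plas}(\mathcal{P}(n),M)$, pointed by the constant map at the weak unit of $M$; this is functorial in $M$ by postcomposition, giving $\mathcal{P}^{(-)}\colon\mathsf{Plas}\to\mathsf{Mod}_{\mathbb{F}_1}$. The functor $\hat{H}\colon\mathsf{Plas}\to\mathsf{Mod}_{\mathbb{F}_1}$. For a plasma $(M,\boxplus,0)$, $$\hat{H}M_n=\{(x_S)_{S\subseteq[n]}: x_S\in M,\ x_\varnothing=0,\ x_{S\cup T}\in x_S\boxplus x_T\text{ whenever }S\cap T=\varnothing\},$$ pointed by the constant family $0$. A morphism $\phi\colon\langle n\rangle\to\langle m\rangle$ acts by $(x_S)_{S\subseteq[n]}\mapsto (x_{\phi^{-1}(T)})_{T\subseteq[m]}$. A plasma morphism $f$ induces $(x_S)_S\mapsto (f(x_S))_S$. *)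

theory Defs
  imports Main "HOL-Library.FuncSet"
begin

section \<open>Categories, functors, natural isomorphisms\<close>

text \<open>
  Categories are given by hom-sets. Composition carries the three objects involved because, for
  morphisms that are extensional functions, the composite must be restricted to the
  source; hom-sets need not be disjoint. For the same reason the action of a functor on morphisms
  takes the source and the target as arguments. Structures are unconstrained outside their
  carriers; hom-sets of functions consist of extensional functions, so that equality of morphisms
  is equality of maps.
\<close>

record ('o, 'm) cat =
  Obj :: "'o set"
  Hom :: "'o \<Rightarrow> 'o \<Rightarrow> 'm set"
  Ident :: "'o \<Rightarrow> 'm"
  Comp :: "'o \<Rightarrow> 'o \<Rightarrow> 'o \<Rightarrow> 'm \<Rightarrow> 'm \<Rightarrow> 'm"  \<comment> \<open>\<open>Comp C a b c g f\<close> is \<open>g \<circ> f : a \<rightarrow> b \<rightarrow> c\<close>\<close>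

locale category =
  fixes C :: "('o, 'm) cat"
  assumes Ident_Hom: "a \<in> Obj C \<Longrightarrow> Ident C a \<in> Hom C a a"
    and Comp_Hom: "\<lbrakk>a \<in> Obj C; b \<in> Obj C; c \<in> Obj C; f \<in> Hom C a b; g \<in> Hom C b c\<rbrakk>
      \<Longrightarrow> Comp C a b c g f \<in> Hom C a c"
    and Comp_Ident: "\<lbrakk>a \<in> Obj C; b \<in> Obj C; f \<in> Hom C a b\<rbrakk>
      \<Longrightarrow> Comp C a a b f (Ident C a) = f"
    and Ident_Comp: "\<lbrakk>a \<in> Obj C; b \<in> Obj C; f \<in> Hom C a b\<rbrakk>
      \<Longrightarrow> Comp C a b b (Ident C b) f = f"
    and Comp_assoc: "\<lbrakk>a \<in> Obj C; b \<in> Obj C; c \<in> Obj C; d \<in> Obj C;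
        f \<in> Hom C a b; g \<in> Hom C b c; h \<in> Hom C c d\<rbrakk>
      \<Longrightarrow> Comp C a c d h (Comp C a b c g f) = Comp C a b d (Comp C b c d h g) f"

definition is_iso :: "('o, 'm) cat \<Rightarrow> 'o \<Rightarrow> 'o \<Rightarrow> 'm \<Rightarrow> bool" where
  "is_iso C a b f \<longleftrightarrow> f \<in> Hom C a b \<and>
     (\<exists>g \<in> Hom C b a. Comp C a b a g f = Ident C a \<and> Comp C b a b f g = Ident C b)"

record ('o, 'm, 'p, 'n) ftor =
  FObj :: "'o \<Rightarrow> 'p"
  FMor :: "'o \<Rightarrow> 'o \<Rightarrow> 'm \<Rightarrow> 'n"

locale cat_functor = C: category C + D: category D
  for C :: "('o, 'm) cat" and D :: "('p, 'n) cat" +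
  fixes F :: "('o, 'm, 'p, 'n) ftor"
  assumes FObj_Obj: "a \<in> Obj C \<Longrightarrow> FObj F a \<in> Obj D"
    and FMor_Hom: "\<lbrakk>a \<in> Obj C; b \<in> Obj C; f \<in> Hom C a b\<rbrakk>
      \<Longrightarrow> FMor F a b f \<in> Hom D (FObj F a) (FObj F b)"
    and FMor_Ident: "a \<in> Obj C \<Longrightarrow> FMor F a a (Ident C a) = Ident D (FObj F a)"
    and FMor_Comp: "\<lbrakk>a \<in> Obj C; b \<in> Obj C; c \<in> Obj C; f \<in> Hom C a b; g \<in> Hom C b c\<rbrakk>
      \<Longrightarrow> FMor F a c (Comp C a b c g f) =
        Comp D (FObj F a) (FObj F b) (FObj F c) (FMor F b c g) (FMor F a b f)"

locale nat_transformation = F: cat_functor C D F + G: cat_functor C D G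
  for C :: "('o, 'm) cat" and D :: "('p, 'n) cat"
    and F G :: "('o, 'm, 'p, 'n) ftor" +
  fixes \<eta> :: "'o \<Rightarrow> 'n"
  assumes component_Hom: "a \<in> Obj C \<Longrightarrow> \<eta> a \<in> Hom D (FObj F a) (FObj G a)"
    and naturality: "\<lbrakk>a \<in> Obj C; b \<in> Obj C; f \<in> Hom C a b\<rbrakk>
      \<Longrightarrow> Comp D (FObj F a) (FObj F b) (FObj G b) (\<eta> b) (FMor F a b f) =
        Comp D (FObj F a) (FObj G a) (FObj G b) (FMor G a b f) (\<eta> a)"

locale nat_isomorphism = nat_transformation C D F G \<eta>
  for C :: "('o, 'm) cat" and D :: "('p, 'n) cat"
    and F G :: "('o, 'm, 'p, 'n) ftor" and \<eta> :: "'o \<Rightarrow> 'n" +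
  assumes component_iso: "a \<in> Obj C \<Longrightarrow> is_iso D (FObj F a) (FObj G a) (\<eta> a)"


section \<open>Pointed sets and \<open>\<F>\<^sub>1\<close>-modules\<close>

record 'a pset =
  Pts :: "'a set"
  Base :: 'a

definition pset_hom :: "'a pset \<Rightarrow> 'b pset \<Rightarrow> ('a \<Rightarrow> 'b) set" where
  "pset_hom A B = {f \<in> Pts A \<rightarrow>\<^sub>E Pts B. f (Base A) = Base B}"

definition Set_pt :: "('a pset, 'a \<Rightarrow> 'a) cat" where
  "Set_pt = \<lparr>Obj = {A. Base A \<in> Pts A}, Hom = pset_hom,
     Ident = (\<lambda>A. \<lambda>x\<in>Pts A. x), Comp = (\<lambda>A B D g f. compose (Pts A) g f)\<rparr>"

definition fin_pset :: "nat \<Rightarrow> nat pset" where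
  "fin_pset n = \<lparr>Pts = {0..n}, Base = 0\<rparr>"

text \<open>The object \<open>\<langle>n\<rangle>\<close> is represented by the number \<open>n\<close>.\<close>

definition Fin_pt :: "(nat, nat \<Rightarrow> nat) cat" where
  "Fin_pt = \<lparr>Obj = UNIV, Hom = (\<lambda>n m. pset_hom (fin_pset n) (fin_pset m)),
     Ident = (\<lambda>n. \<lambda>i\<in>Pts (fin_pset n). i),
     Comp = (\<lambda>n m k g f. compose (Pts (fin_pset n)) g f)\<rparr>"

type_synonym 'x F1_module = "(nat, nat \<Rightarrow> nat, 'x pset, 'x \<Rightarrow> 'x) ftor"

definition F1_module :: "'x F1_module \<Rightarrow> bool" where
  "F1_module X \<longleftrightarrow> cat_functor Fin_pt Set_pt X \<and> is_singleton (Pts (FObj X 0))"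

definition Mod_F1 :: "('x F1_module, nat \<Rightarrow> 'x \<Rightarrow> 'x) cat" where
  "Mod_F1 = \<lparr>Obj = {X. F1_module X},
     Hom = (\<lambda>X Y. {\<alpha>. nat_transformation Fin_pt Set_pt X Y \<alpha>}),
     Ident = (\<lambda>X n. Ident Set_pt (FObj X n)),
     Comp = (\<lambda>X Y Z \<beta> \<alpha> n. Comp Set_pt (FObj X n) (FObj Y n) (FObj Z n) (\<beta> n) (\<alpha> n))\<rparr>"


section \<open>Plasmas\<close>

record 'a plasma =
  Carr :: "'a set"
  hyp :: "'a \<Rightarrow> 'a \<Rightarrow> 'a set"
  wunit :: 'a

definition is_plasma :: "'a plasma \<Rightarrow> bool" where
  "is_plasma M \<longleftrightarrow> wunit M \<in> Carr M
     \<and> (\<forall>a\<in>Carr M. \<forall>b\<in>Carr M. hyp M a b \<subseteq> Carr M)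
     \<and> (\<forall>a\<in>Carr M. a \<in> hyp M (wunit M) a)
     \<and> (\<forall>a\<in>Carr M. \<forall>b\<in>Carr M. hyp M a b = hyp M b a)"

definition plasma_hom :: "'a plasma \<Rightarrow> 'b plasma \<Rightarrow> ('a \<Rightarrow> 'b) set" where
  "plasma_hom M N = {f \<in> Carr M \<rightarrow>\<^sub>E Carr N. f (wunit M) = wunit N
     \<and> (\<forall>a\<in>Carr M. \<forall>b\<in>Carr M. f ` hyp M a b \<subseteq> hyp N (f a) (f b))}"

text \<open>The category of all plasmas whose underlying set is a subset of the type \<open>'a\<close>, which
  plays the role of the universe.\<close>

definition Plas :: "('a plasma, 'a \<Rightarrow> 'a) cat" where
  "Plas = \<lparr>Obj = {M. is_plasma M}, Hom = plasma_hom,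
     Ident = (\<lambda>M. \<lambda>x\<in>Carr M. x), Comp = (\<lambda>M N K g f. compose (Carr M) g f)\<rparr>"


section \<open>The functors \<open>\<P>\<^sup>(\<^sup>-\<^sup>)\<close> and \<open>H\<close>\<close>

definition pow_plasma :: "nat \<Rightarrow> nat set plasma" where
  "pow_plasma n = \<lparr>Carr = Pow {1..n},
     hyp = (\<lambda>X Y. if X \<inter> Y = {} then {X \<union> Y} else {}), wunit = {}\<rparr>"

text \<open>For \<open>\<phi> : \<langle>n\<rangle> \<rightarrow> \<langle>m\<rangle>\<close> and \<open>X \<subseteq> {1..m}\<close>, the preimage of \<open>X\<close> under
  \<open>\<phi>\<close>; it does not contain the base point as \<open>\<phi> 0 = 0\<close>.\<close>

definition preim :: "nat \<Rightarrow> (nat \<Rightarrow> nat) \<Rightarrow> nat set \<Rightarrow> nat set" where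
  "preim n \<phi> X = {i \<in> {0..n}. \<phi> i \<in> X}"

definition pow_plasma_map :: "nat \<Rightarrow> nat \<Rightarrow> (nat \<Rightarrow> nat) \<Rightarrow> nat set \<Rightarrow> nat set" where
  "pow_plasma_map n m \<phi> = (\<lambda>X\<in>Carr (pow_plasma m). preim n \<phi> X)"

definition pow_module :: "'a plasma \<Rightarrow> (nat set \<Rightarrow> 'a) F1_module" where
  "pow_module M = \<lparr>
     FObj = (\<lambda>n. \<lparr>Pts = plasma_hom (pow_plasma n) M,
                  Base = (\<lambda>X\<in>Carr (pow_plasma n). wunit M)\<rparr>),
     FMor = (\<lambda>n m \<phi>. \<lambda>f\<in>plasma_hom (pow_plasma n) M.
               compose (Carr (pow_plasma m)) f (pow_plasma_map n m \<phi>))\<rparr>"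

definition pow_functor ::
  "('a plasma, 'a \<Rightarrow> 'a, (nat set \<Rightarrow> 'a) F1_module,
    nat \<Rightarrow> (nat set \<Rightarrow> 'a) \<Rightarrow> (nat set \<Rightarrow> 'a)) ftor" where
  "pow_functor = \<lparr>
     FObj = pow_module,
     FMor = (\<lambda>M N f n. \<lambda>g\<in>plasma_hom (pow_plasma n) M. compose (Carr (pow_plasma n)) f g)\<rparr>"

definition H_set :: "'a plasma \<Rightarrow> nat \<Rightarrow> (nat set \<Rightarrow> 'a) set" where
  "H_set M n = {x \<in> Pow {1..n} \<rightarrow>\<^sub>E Carr M. x {} = wunit M
     \<and> (\<forall>S T. S \<subseteq> {1..n} \<longrightarrow> T \<subseteq> {1..n} \<longrightarrow> S \<inter> T = {} \<longrightarrow> x (S \<union> T) \<in> hyp M (x S) (x T))}"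

definition H_module :: "'a plasma \<Rightarrow> (nat set \<Rightarrow> 'a) F1_module" where
  "H_module M = \<lparr>
     FObj = (\<lambda>n. \<lparr>Pts = H_set M n, Base = (\<lambda>S\<in>Pow {1..n}. wunit M)\<rparr>),
     FMor = (\<lambda>n m \<phi>. \<lambda>x\<in>H_set M n. \<lambda>T\<in>Pow {1..m}. x (preim n \<phi> T))\<rparr>"

definition H_functor ::
  "('a plasma, 'a \<Rightarrow> 'a, (nat set \<Rightarrow> 'a) F1_module,
    nat \<Rightarrow> (nat set \<Rightarrow> 'a) \<Rightarrow> (nat set \<Rightarrow> 'a)) ftor" where
  "H_functor = \<lparr>
     FObj = H_module,
     FMor = (\<lambda>M N f n. \<lambda>x\<in>H_set M n. \<lambda>S\<in>Pow {1..n}. f (x S))\<rparr>"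

end

theory Submission
  imports Defs
begin

text \<open>
  A plasma morphism \<open>f : \<P>(n) \<rightarrow> M\<close> is nothing but the family of its values \<open>f S\<close>.
  The sum of two subsets in \<open>\<P>(n)\<close> is a singleton or empty. For disjoint \<open>S\<close> and \<open>T\<close> the
  inclusion that \<open>f\<close> must satisfy therefore says \<open>f (S \<union> T) \<in> f S \<boxplus> f T\<close>, and for all other
  pairs it is vacuous. Hence the morphisms are exactly the families in \<open>H_set M n\<close>. Precomposing
  with \<open>\<P>(\<phi>)\<close> is reindexing along preimages, and postcomposing with \<open>f\<close> is applying \<open>f\<close> to
  every member.

  Since a family indexed by subsets is encoded as an extensional function, this correspondence is
  an equality of functors (\<open>pow_functor_eq_H_functor\<close>), and the natural isomorphism is the identity
  transformation. The mathematical content that remains is that \<open>H_functor\<close> really is a functor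
  from plasmas to \<open>\<F>\<^sub>1\<close>-modules (\<open>cat_functor_H_functor\<close>).
\<close>

section \<open>Identity and composite natural transformations\<close>

context cat_functor
begin

lemma nat_transformation_Ident:
  "nat_transformation C D F F (\<lambda>a. Ident D (FObj F a))"
  by unfold_locales (simp_all add: FObj_Obj D.Ident_Hom FMor_Hom D.Comp_Ident D.Ident_Comp)

lemma nat_isomorphism_Ident:
  "nat_isomorphism C D F F (\<lambda>a. Ident D (FObj F a))"
proof -
  interpret I: nat_transformation C D F F "\<lambda>a. Ident D (FObj F a)"
    by (rule nat_transformation_Ident)
  show ?thesis
  proof unfold_locales
    fix a assume "a \<in> Obj C"
    then have a: "FObj F a \<in> Obj D" by (rule FObj_Obj)
    show "is_iso D (FObj F a) (FObj F a) (Ident D (FObj F a))"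
      unfolding is_iso_def using D.Ident_Hom[OF a] D.Comp_Ident[OF a a D.Ident_Hom[OF a]] by blast
  qed
qed

end

lemma nat_transformation_Comp:
  assumes "nat_transformation C D F G \<alpha>" and "nat_transformation C D G H \<beta>"
  shows "nat_transformation C D F H
    (\<lambda>a. Comp D (FObj F a) (FObj G a) (FObj H a) (\<beta> a) (\<alpha> a))"
proof -
  interpret \<alpha>: nat_transformation C D F G \<alpha> by fact
  interpret \<beta>: nat_transformation C D G H \<beta> by fact
  show ?thesis
  proof unfold_locales
    fix a assume a: "a \<in> Obj C"
    then show "Comp D (FObj F a) (FObj G a) (FObj H a) (\<beta> a) (\<alpha> a) \<in> Hom D (FObj F a) (FObj H a)"
      by (intro \<alpha>.F.D.Comp_Hom) (auto intro: \<alpha>.F.FObj_Obj \<alpha>.G.FObj_Obj \<beta>.G.FObj_Obj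
          \<alpha>.component_Hom \<beta>.component_Hom)
  next
    fix a b f assume a: "a \<in> Obj C" and b: "b \<in> Obj C" and f: "f \<in> Hom C a b"
    note obj = \<alpha>.F.FObj_Obj[OF a] \<alpha>.F.FObj_Obj[OF b] \<alpha>.G.FObj_Obj[OF a] \<alpha>.G.FObj_Obj[OF b]
      \<beta>.G.FObj_Obj[OF a] \<beta>.G.FObj_Obj[OF b]
    note hom = \<alpha>.F.FMor_Hom[OF a b f] \<alpha>.G.FMor_Hom[OF a b f] \<beta>.G.FMor_Hom[OF a b f]
      \<alpha>.component_Hom[OF a] \<alpha>.component_Hom[OF b] \<beta>.component_Hom[OF a] \<beta>.component_Hom[OF b]
    let ?F = "FObj F" and ?G = "FObj G" and ?H = "FObj H"
    have "Comp D (?F a) (?F b) (?H b) (Comp D (?F b) (?G b) (?H b) (\<beta> b) (\<alpha> b)) (FMor F a b f)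
        = Comp D (?F a) (?G b) (?H b) (\<beta> b) (Comp D (?F a) (?F b) (?G b) (\<alpha> b) (FMor F a b f))"
      by (rule \<alpha>.F.D.Comp_assoc[symmetric]) (fact obj hom)+
    also have "\<dots> = Comp D (?F a) (?G b) (?H b) (\<beta> b)
        (Comp D (?F a) (?G a) (?G b) (FMor G a b f) (\<alpha> a))"
      by (simp only: \<alpha>.naturality[OF a b f])
    also have "\<dots> = Comp D (?F a) (?G a) (?H b)
        (Comp D (?G a) (?G b) (?H b) (\<beta> b) (FMor G a b f)) (\<alpha> a)"
      by (rule \<alpha>.F.D.Comp_assoc) (fact obj hom)+
    also have "\<dots> = Comp D (?F a) (?G a) (?H b)
        (Comp D (?G a) (?H a) (?H b) (FMor H a b f) (\<beta> a)) (\<alpha> a)"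
      by (simp only: \<beta>.naturality[OF a b f])
    also have "\<dots> = Comp D (?F a) (?H a) (?H b) (FMor H a b f)
        (Comp D (?F a) (?G a) (?H a) (\<beta> a) (\<alpha> a))"
      by (rule \<alpha>.F.D.Comp_assoc[symmetric]) (fact obj hom)+
    finally show "Comp D (?F a) (?F b) (?H b) (Comp D (?F b) (?G b) (?H b) (\<beta> b) (\<alpha> b))
          (FMor F a b f)
        = Comp D (?F a) (?H a) (?H b) (FMor H a b f)
          (Comp D (?F a) (?G a) (?H a) (\<beta> a) (\<alpha> a))" .
  qed
qed

section \<open>The categories involved\<close>

lemma compose_pset_hom:
  assumes "Base A \<in> Pts A" and "f \<in> pset_hom A B" and "g \<in> pset_hom B D"
  shows "compose (Pts A) g f \<in> pset_hom A D"
  using assms by (auto simp: pset_hom_def compose_def)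

lemma category_Set_pt: "category Set_pt"
proof
  fix A B D :: "'a pset" and f g
  assume "A \<in> Obj Set_pt" "f \<in> Hom Set_pt A B" "g \<in> Hom Set_pt B D"
  then show "Comp Set_pt A B D g f \<in> Hom Set_pt A D"
    by (simp add: Set_pt_def compose_pset_hom)
qed (auto simp: Set_pt_def pset_hom_def PiE_def compose_Id Id_compose intro: compose_assoc)

lemma category_Fin_pt: "category Fin_pt"
proof
  fix n m k f g
  assume "f \<in> Hom Fin_pt n m" "g \<in> Hom Fin_pt m k"
  then show "Comp Fin_pt n m k g f \<in> Hom Fin_pt n k"
    using compose_pset_hom[of "fin_pset n" f "fin_pset m" g "fin_pset k"]
    by (simp add: Fin_pt_def fin_pset_def)
qed (auto simp: Fin_pt_def fin_pset_def pset_hom_def PiE_def compose_Id Id_compose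
    intro: compose_assoc)

lemma is_plasmaD:
  assumes "is_plasma M"
  shows "wunit M \<in> Carr M"
    and "\<lbrakk>a \<in> Carr M; b \<in> Carr M\<rbrakk> \<Longrightarrow> hyp M a b \<subseteq> Carr M"
    and "a \<in> Carr M \<Longrightarrow> a \<in> hyp M (wunit M) a"
  using assms unfolding is_plasma_def by blast+

lemma plasma_homD:
  assumes "f \<in> plasma_hom M N"
  shows "a \<in> Carr M \<Longrightarrow> f a \<in> Carr N"
    and "f (wunit M) = wunit N"
    and "\<lbrakk>a \<in> Carr M; b \<in> Carr M; c \<in> hyp M a b\<rbrakk> \<Longrightarrow> f c \<in> hyp N (f a) (f b)"
  using assms unfolding plasma_hom_def by blast+

lemma compose_plasma_hom:
  assumes M: "is_plasma M" and f: "f \<in> plasma_hom M N" and g: "g \<in> plasma_hom N K"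
  shows "compose (Carr M) g f \<in> plasma_hom M K"
proof -
  note f' = plasma_homD[OF f] and g' = plasma_homD[OF g]
  have "compose (Carr M) g f ` hyp M a b
      \<subseteq> hyp K (compose (Carr M) g f a) (compose (Carr M) g f b)"
    if ab: "a \<in> Carr M" "b \<in> Carr M" for a b
  proof (rule image_subsetI)
    fix c assume c: "c \<in> hyp M a b"
    then have "c \<in> Carr M" using is_plasmaD(2)[OF M ab] by blast
    then show "compose (Carr M) g f c \<in> hyp K (compose (Carr M) g f a) (compose (Carr M) g f b)"
      using ab g'(3)[OF f'(1)[OF ab(1)] f'(1)[OF ab(2)] f'(3)[OF ab c]] by (simp add: compose_def)
  qed
  moreover have "compose (Carr M) g f \<in> Carr M \<rightarrow>\<^sub>E Carr K"
    using f'(1) g'(1) by (simp add: compose_def)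
  moreover have "compose (Carr M) g f (wunit M) = wunit K"
    using is_plasmaD(1)[OF M] f'(2) g'(2) by (simp add: compose_def)
  ultimately show ?thesis by (simp add: plasma_hom_def)
qed

lemma category_Plas: "category Plas"
proof
  fix M :: "'a plasma" assume "M \<in> Obj Plas"
  then show "Ident Plas M \<in> Hom Plas M M"
    using is_plasmaD(1,2)[of M] by (fastforce simp: Plas_def plasma_hom_def)
next
  fix M N K :: "'a plasma" and f g
  assume "M \<in> Obj Plas" "f \<in> Hom Plas M N" "g \<in> Hom Plas N K"
  then show "Comp Plas M N K g f \<in> Hom Plas M K"
    by (simp add: Plas_def compose_plasma_hom)
qed (auto simp: Plas_def plasma_hom_def PiE_def compose_Id Id_compose intro: compose_assoc)

text \<open>Identities and composites are formed componentwise, so the unit and associativity laws are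
  those of pointed sets at every \<open>n\<close>.\<close>

lemma category_Mod_F1: "category Mod_F1"
proof -
  interpret S: category Set_pt by (rule category_Set_pt)
  have obj: "FObj X n \<in> Obj Set_pt" if "X \<in> Obj Mod_F1" for X :: "'x F1_module" and n
  proof -
    interpret cat_functor Fin_pt Set_pt X
      using that by (simp add: Mod_F1_def F1_module_def)
    show ?thesis by (rule FObj_Obj) (simp add: Fin_pt_def)
  qed
  have hom: "\<alpha> n \<in> Hom Set_pt (FObj X n) (FObj Y n)"
    if "\<alpha> \<in> Hom Mod_F1 X Y" for X Y :: "'x F1_module" and \<alpha> n
  proof -
    interpret nat_transformation Fin_pt Set_pt X Y \<alpha>
      using that by (simp add: Mod_F1_def)
    show ?thesis by (rule component_Hom) (simp add: Fin_pt_def)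
  qed
  show ?thesis
  proof
    fix X :: "'x F1_module" assume "X \<in> Obj Mod_F1"
    then show "Ident Mod_F1 X \<in> Hom Mod_F1 X X"
      by (simp add: Mod_F1_def F1_module_def cat_functor.nat_transformation_Ident)
  next
    fix X Y Z :: "'x F1_module" and \<alpha> \<beta>
    assume "\<alpha> \<in> Hom Mod_F1 X Y" "\<beta> \<in> Hom Mod_F1 Y Z"
    then show "Comp Mod_F1 X Y Z \<beta> \<alpha> \<in> Hom Mod_F1 X Z"
      by (simp add: Mod_F1_def nat_transformation_Comp)
  next
    fix X Y :: "'x F1_module" and \<alpha>
    assume *: "X \<in> Obj Mod_F1" "Y \<in> Obj Mod_F1" "\<alpha> \<in> Hom Mod_F1 X Y"
    show "Comp Mod_F1 X X Y \<alpha> (Ident Mod_F1 X) = \<alpha>"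
      using S.Comp_Ident[OF obj[OF *(1)] obj[OF *(2)] hom[OF *(3)]] by (simp add: Mod_F1_def)
    show "Comp Mod_F1 X Y Y (Ident Mod_F1 Y) \<alpha> = \<alpha>"
      using S.Ident_Comp[OF obj[OF *(1)] obj[OF *(2)] hom[OF *(3)]] by (simp add: Mod_F1_def)
  next
    fix X Y Z W :: "'x F1_module" and \<alpha> \<beta> \<gamma>
    assume *: "X \<in> Obj Mod_F1" "Y \<in> Obj Mod_F1" "Z \<in> Obj Mod_F1" "W \<in> Obj Mod_F1"
      "\<alpha> \<in> Hom Mod_F1 X Y" "\<beta> \<in> Hom Mod_F1 Y Z" "\<gamma> \<in> Hom Mod_F1 Z W"
    show "Comp Mod_F1 X Z W \<gamma> (Comp Mod_F1 X Y Z \<beta> \<alpha>)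
        = Comp Mod_F1 X Y W (Comp Mod_F1 Y Z W \<gamma> \<beta>) \<alpha>"
      using S.Comp_assoc[OF *(1-4)[THEN obj] *(5-7)[THEN hom]] by (simp add: Mod_F1_def)
  qed
qed

section \<open>The functor of additive families\<close>

lemma H_setD:
  assumes "x \<in> H_set M n"
  shows "x \<in> extensional (Pow {1..n})"
    and "S \<subseteq> {1..n} \<Longrightarrow> x S \<in> Carr M"
    and "x {} = wunit M"
    and "\<lbrakk>S \<subseteq> {1..n}; T \<subseteq> {1..n}; S \<inter> T = {}\<rbrakk> \<Longrightarrow> x (S \<union> T) \<in> hyp M (x S) (x T)"
  using assms by (auto simp: H_set_def PiE_iff)

text \<open>Additivity of the zero family is the weak unit law at the unit itself,
  \<open>0 \<in> 0 \<boxplus> 0\<close>.\<close>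

lemma zero_family_in_H_set:
  assumes "is_plasma M"
  shows "(\<lambda>S\<in>Pow {1..n}. wunit M) \<in> H_set M n"
  using is_plasmaD(1)[OF assms] is_plasmaD(3)[OF assms is_plasmaD(1)[OF assms]]
  by (simp add: H_set_def)

lemma preim_subset:
  assumes "\<phi> \<in> Hom Fin_pt n m" and "T \<subseteq> {1..m}"
  shows "preim n \<phi> T \<subseteq> {1..n}"
proof
  fix i assume i: "i \<in> preim n \<phi> T"
  \<comment> \<open>The base point is sent to \<open>0\<close>, which lies outside \<open>T\<close>.\<close>
  have "\<phi> 0 = 0" using assms(1) by (simp add: Fin_pt_def pset_hom_def fin_pset_def)
  moreover have "0 \<notin> T" using assms(2) by auto
  ultimately have "i \<noteq> 0" using i by (metis (no_types, lifting) mem_Collect_eq preim_def)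
  with i show "i \<in> {1..n}" by (simp add: preim_def)
qed

lemma preim_Ident: "T \<subseteq> {1..n} \<Longrightarrow> preim n (Ident Fin_pt n) T = T"
  by (auto simp: preim_def Fin_pt_def fin_pset_def)

lemma preim_Comp:
  assumes "\<phi> \<in> Hom Fin_pt n m"
  shows "preim n (Comp Fin_pt n m k \<psi> \<phi>) T = preim n \<phi> (preim m \<psi> T)"
  using assms
  by (auto simp: preim_def Fin_pt_def pset_hom_def fin_pset_def compose_def PiE_iff)

text \<open>Preimages preserve disjoint unions and the empty set, so additivity survives
  reindexing.\<close>

lemma H_set_reindex:
  assumes \<phi>: "\<phi> \<in> Hom Fin_pt n m" and x: "x \<in> H_set M n"
  shows "(\<lambda>T\<in>Pow {1..m}. x (preim n \<phi> T)) \<in> H_set M m"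
proof -
  have "x (preim n \<phi> (S \<union> T)) \<in> hyp M (x (preim n \<phi> S)) (x (preim n \<phi> T))"
    if "S \<subseteq> {1..m}" "T \<subseteq> {1..m}" "S \<inter> T = {}" for S T
  proof -
    have "preim n \<phi> (S \<union> T) = preim n \<phi> S \<union> preim n \<phi> T" "preim n \<phi> S \<inter> preim n \<phi> T = {}"
      using that(3) by (auto simp: preim_def)
    then show ?thesis
      using H_setD(4)[OF x] preim_subset[OF \<phi>] that(1,2) by simp
  qed
  moreover have "preim n \<phi> {} = {}" by (simp add: preim_def)
  ultimately show ?thesis
    using H_setD(2,3)[OF x] preim_subset[OF \<phi>] by (auto simp: H_set_def)
qed

lemma H_set_map:
  assumes f: "f \<in> plasma_hom M N" and x: "x \<in> H_set M n"
  shows "(\<lambda>S\<in>Pow {1..n}. f (x S)) \<in> H_set N n"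
proof -
  show ?thesis
    using plasma_homD[OF f] H_setD(2-4)[OF x] by (simp add: H_set_def)
qed

lemma cat_functor_H_module:
  assumes M: "is_plasma M"
  shows "cat_functor Fin_pt Set_pt (H_module M)"
proof -
  interpret F: category Fin_pt by (rule category_Fin_pt)
  interpret S: category Set_pt by (rule category_Set_pt)
  show ?thesis
  proof
    fix n show "FObj (H_module M) n \<in> Obj Set_pt"
      using zero_family_in_H_set[OF M] by (simp add: H_module_def Set_pt_def)
  next
    fix n m \<phi> assume \<phi>: "\<phi> \<in> Hom Fin_pt n m"
    have "(\<lambda>T\<in>Pow {1..m}. (\<lambda>S\<in>Pow {1..n}. wunit M) (preim n \<phi> T)) = (\<lambda>T\<in>Pow {1..m}. wunit M)"
      by (rule restrict_ext) (use preim_subset[OF \<phi>] in simp)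
    then show "FMor (H_module M) n m \<phi> \<in> Hom Set_pt (FObj (H_module M) n) (FObj (H_module M) m)"
      using H_set_reindex[OF \<phi>, where M = M] zero_family_in_H_set[OF M]
      by (simp add: H_module_def Set_pt_def pset_hom_def)
  next
    fix n
    have "(\<lambda>T\<in>Pow {1..n}. x (preim n (Ident Fin_pt n) T)) = x" if "x \<in> H_set M n" for x
      using H_setD(1)[OF that] by (auto simp: fun_eq_iff preim_Ident extensional_def)
    then show "FMor (H_module M) n n (Ident Fin_pt n) = Ident Set_pt (FObj (H_module M) n)"
      by (auto simp: H_module_def Set_pt_def)
  next
    fix n m k \<phi> \<psi> assume \<phi>: "\<phi> \<in> Hom Fin_pt n m" and \<psi>: "\<psi> \<in> Hom Fin_pt m k"
    have "(\<lambda>T\<in>Pow {1..k}. x (preim n (Comp Fin_pt n m k \<psi> \<phi>) T)) =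
        (\<lambda>T\<in>Pow {1..k}. (\<lambda>T\<in>Pow {1..m}. x (preim n \<phi> T)) (preim m \<psi> T))" for x :: "nat set \<Rightarrow> 'a"
      using preim_subset[OF \<psi>] by (auto simp: preim_Comp[OF \<phi>] fun_eq_iff)
    then show "FMor (H_module M) n k (Comp Fin_pt n m k \<psi> \<phi>) =
        Comp Set_pt (FObj (H_module M) n) (FObj (H_module M) m) (FObj (H_module M) k)
          (FMor (H_module M) m k \<psi>) (FMor (H_module M) n m \<phi>)"
      using H_set_reindex[OF \<phi>] by (auto simp: H_module_def Set_pt_def compose_def fun_eq_iff)
  qed
qed

lemma F1_module_H_module:
  assumes M: "is_plasma M"
  shows "F1_module (H_module M)"
proof -
  \<comment> \<open>A family indexed by the subsets of the empty set is its single member \<open>x {} = wunit M\<close>.\<close>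
  have "x = (\<lambda>S\<in>Pow {1..0}. wunit M)" if "x \<in> H_set M 0" for x
    using H_setD(1,3)[OF that] by (auto simp: fun_eq_iff extensional_def)
  then have "H_set M 0 = {\<lambda>S\<in>Pow {1..0}. wunit M}"
    using zero_family_in_H_set[OF M, of 0] by blast
  then show ?thesis
    using cat_functor_H_module[OF M] by (simp add: F1_module_def H_module_def is_singleton_def)
qed

text \<open>Applying \<open>f\<close> to the members of a family and reindexing the family act on different sides of
  the function \<open>S \<mapsto> x S\<close>, hence commute; this is the naturality in \<open>\<langle>n\<rangle>\<close>.\<close>

lemma nat_transformation_H_functor:
  assumes M: "is_plasma M" and N: "is_plasma N" and f: "f \<in> plasma_hom M N"
  shows "nat_transformation Fin_pt Set_pt (H_module M) (H_module N) (FMor H_functor M N f)"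
proof -
  interpret M: cat_functor Fin_pt Set_pt "H_module M" by (rule cat_functor_H_module[OF M])
  interpret N: cat_functor Fin_pt Set_pt "H_module N" by (rule cat_functor_H_module[OF N])
  have unit: "wunit M \<in> Carr M" "f (wunit M) = wunit N"
    using is_plasmaD(1)[OF M] plasma_homD(2)[OF f] by auto
  show ?thesis
  proof
    fix n
    show "FMor H_functor M N f n \<in> Hom Set_pt (FObj (H_module M) n) (FObj (H_module N) n)"
      using H_set_map[OF f] zero_family_in_H_set[OF M] unit
      by (auto simp: H_functor_def H_module_def Set_pt_def pset_hom_def fun_eq_iff)
  next
    fix n m \<phi> assume \<phi>: "\<phi> \<in> Hom Fin_pt n m"
    show "Comp Set_pt (FObj (H_module M) n) (FObj (H_module M) m) (FObj (H_module N) m)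
          (FMor H_functor M N f m) (FMor (H_module M) n m \<phi>) =
        Comp Set_pt (FObj (H_module M) n) (FObj (H_module N) n) (FObj (H_module N) m)
          (FMor (H_module N) n m \<phi>) (FMor H_functor M N f n)"
      using H_set_map[OF f] H_set_reindex[OF \<phi>] preim_subset[OF \<phi>]
      by (auto simp: H_functor_def H_module_def Set_pt_def compose_def fun_eq_iff)
  qed
qed

lemma cat_functor_H_functor: "cat_functor Plas Mod_F1 H_functor"
proof -
  interpret P: category Plas by (rule category_Plas)
  interpret Q: category Mod_F1 by (rule category_Mod_F1)
  show ?thesis
  proof
    fix M :: "'a plasma" assume "M \<in> Obj Plas"
    then show "FObj H_functor M \<in> Obj Mod_F1"
      by (simp add: H_functor_def Plas_def Mod_F1_def F1_module_H_module)
  next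
    fix M N :: "'a plasma" and f assume "M \<in> Obj Plas" "N \<in> Obj Plas" "f \<in> Hom Plas M N"
    then have "nat_transformation Fin_pt Set_pt (H_module M) (H_module N) (FMor H_functor M N f)"
      by (simp add: Plas_def nat_transformation_H_functor)
    then show "FMor H_functor M N f \<in> Hom Mod_F1 (FObj H_functor M) (FObj H_functor N)"
      by (simp add: Mod_F1_def H_functor_def)
  next
    fix M :: "'a plasma"
    have "(\<lambda>S\<in>Pow {1..n}. Ident Plas M (x S)) = x" if "x \<in> H_set M n" for x n
      using H_setD(1,2)[OF that] by (auto simp: fun_eq_iff extensional_def Plas_def)
    then show "FMor H_functor M M (Ident Plas M) = Ident Mod_F1 (FObj H_functor M)"
      by (auto simp: H_functor_def H_module_def Mod_F1_def Set_pt_def fun_eq_iff)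
  next
    fix M N K :: "'a plasma" and f g
    assume f: "f \<in> Hom Plas M N"
    have "(\<lambda>S\<in>Pow {1..n}. Comp Plas M N K g f (x S)) =
        (\<lambda>S\<in>Pow {1..n}. g ((\<lambda>S\<in>Pow {1..n}. f (x S)) S))" if "x \<in> H_set M n" for x n
      using H_setD(2)[OF that] by (auto simp: fun_eq_iff Plas_def compose_def)
    moreover have "(\<lambda>S\<in>Pow {1..n}. f (x S)) \<in> H_set N n" if "x \<in> H_set M n" for x n
      using H_set_map[of f M N] f that by (simp add: Plas_def)
    ultimately show "FMor H_functor M K (Comp Plas M N K g f) =
        Comp Mod_F1 (FObj H_functor M) (FObj H_functor N) (FObj H_functor K)
          (FMor H_functor N K g) (FMor H_functor M N f)"
      by (auto simp: H_functor_def H_module_def Mod_F1_def Set_pt_def compose_def fun_eq_iff)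
  qed
qed

section \<open>Morphisms out of the subset plasmas are additive families\<close>

text \<open>On disjoint subsets the sum in \<open>\<P>(n)\<close> is \<open>{S \<union> T}\<close>, which gives the additivity
  condition. On the other pairs it is empty, and so is its image under any map.\<close>

lemma plasma_hom_pow_plasma: "plasma_hom (pow_plasma n) M = H_set M n"
  by (auto simp: plasma_hom_def H_set_def pow_plasma_def)

lemma pow_module_eq_H_module: "pow_module M = H_module M"
proof -
  have "compose (Carr (pow_plasma m)) x (pow_plasma_map n m \<phi>) = (\<lambda>T\<in>Pow {1..m}. x (preim n \<phi> T))"
    for n m \<phi> and x :: "nat set \<Rightarrow> 'a"
    by (auto simp: compose_def pow_plasma_map_def pow_plasma_def)
  then show ?thesis
    by (simp add: pow_module_def H_module_def plasma_hom_pow_plasma) (simp add: pow_plasma_def)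
qed

lemma pow_functor_eq_H_functor: "pow_functor = H_functor"
  by (simp add: pow_functor_def H_functor_def plasma_hom_pow_plasma pow_module_eq_H_module
      compose_def fun_eq_iff) (simp add: pow_plasma_def)

theorem theorem4p9:
  "\<exists>\<eta> :: 'a plasma \<Rightarrow> nat \<Rightarrow> (nat set \<Rightarrow> 'a) \<Rightarrow> (nat set \<Rightarrow> 'a).
     nat_isomorphism Plas Mod_F1 pow_functor H_functor \<eta>"
  unfolding pow_functor_eq_H_functor
  using cat_functor.nat_isomorphism_Ident[OF cat_functor_H_functor] by blast

end
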